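(* Let $\tau$ be a finite unary vocabulary, $t = 2^{|\tau|}$, $d$ a positive integer, $\mathfrak{M}$ a $\tau$-model of size $n$, and $h\in\{1,\dots,d-1\}$. If \[ H_B^d(\mathfrak{M}) > \log\binom{n}{h\ \dots\ h\ \ n-(t-1)h}, \] where the multinomial coefficient has $t-1$ entries equal to $h$ and one entry $n-(t-1)h$, then $C_d(\mathfrak{M}) > 3h - 3$.
   Context: All logarithms are base 2. A $\tau$-model of size $n$ has domain $\{1,\dots,n\}$ and interprets each unary symbol as a subset. A type is a subset $\pi\subseteq\tau$; $|\pi|_{\mathfrak{M}}$ is the number of points in exactly the relations named in $\pi$. For models of size $n$, $\mathfrak{M}\equiv_d\mathfrak{M}'$ iff every type $\pi$ with $|\pi|_{\mathfrak{M}}<d$ has $|\pi|_{\mathfrak{M}}=|\pi|_{\mathfrak{M}'}$. $H_B^d(\mathfrak{M}) = \log|\mathcal{M}|$ where $\mathcal{M}$ is the $\equiv_d$-class of $\mathfrak{M}$ among $\tau$-models with domain $\{1,\dots,n\}$. $\mathrm{FO}_d[\tau]$ is first-order logic (negation normal form) of quantifier rank at most $d$; size counts atomic formulas (negated or not), conjunctions, disjunctions and quantifiers, not negations. $C_d(\mathfrak{M})$ is the minimum size of an $\mathrm{FO}_d[\tau]$-sentence true in exactly the $\tau$-models of size $n$ that are $\equiv_d$-equivalent to $\mathfrak{M}$.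
   Formalization: Proved assuming th ≤ n, i.e. the entry n-(t-1)h is at least h; without a condition of this kind the claim fails (τ={P}, n=h=4, d=5, one point in P). The relation ≡_d is read symmetrically: counts must agree whenever a type has fewer than d points in either model. *)

theory Defs
  imports Complex_Main "HOL-Library.FuncSet"
begin

text \<open>
  A vocabulary is a set \<open>\<tau> :: 'p set\<close> of unary relation symbols. Interpretations are extensional
  outside \<open>\<tau>\<close>, so that distinct elements of \<open>models \<tau> n\<close> are distinct as \<open>\<tau>\<close>-models and
  cardinalities of sets of models are the intended ones.
\<close>

definition models :: "'p set \<Rightarrow> nat \<Rightarrow> ('p \<Rightarrow> nat set) set" where
  "models \<tau> n = \<tau> \<rightarrow>\<^sub>E Pow {1..n}"

definition type_count :: "'p set \<Rightarrow> nat \<Rightarrow> ('p \<Rightarrow> nat set) \<Rightarrow> 'p set \<Rightarrow> nat" where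
  "type_count \<tau> n M \<pi> = card {a \<in> {1..n}. {P \<in> \<tau>. a \<in> M P} = \<pi>}"

text \<open>
  The condition is imposed as soon as \<open>\<pi>\<close> has fewer than \<open>d\<close> realizing points in one of the two
  models. Requiring it only for the types that are small in the first model would not give a
  symmetric relation.
\<close>

definition equiv_d :: "'p set \<Rightarrow> nat \<Rightarrow> nat \<Rightarrow> ('p \<Rightarrow> nat set) \<Rightarrow> ('p \<Rightarrow> nat set) \<Rightarrow> bool" where
  "equiv_d \<tau> n d M M' \<longleftrightarrow>
     (\<forall>\<pi>\<subseteq>\<tau>. type_count \<tau> n M \<pi> < d \<or> type_count \<tau> n M' \<pi> < d \<longrightarrow>
        type_count \<tau> n M \<pi> = type_count \<tau> n M' \<pi>)"

definition equiv_class :: "'p set \<Rightarrow> nat \<Rightarrow> nat \<Rightarrow> ('p \<Rightarrow> nat set) \<Rightarrow> ('p \<Rightarrow> nat set) set" where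
  "equiv_class \<tau> n d M = {M' \<in> models \<tau> n. equiv_d \<tau> n d M M'}"

definition boltzmann_entropy :: "'p set \<Rightarrow> nat \<Rightarrow> nat \<Rightarrow> ('p \<Rightarrow> nat set) \<Rightarrow> real" where
  "boltzmann_entropy \<tau> n d M = log 2 (real (card (equiv_class \<tau> n d M)))"

text \<open>First-order formulas with equality in negation normal form; variables are natural numbers.\<close>

datatype 'p fo =
    Eq nat nat
  | NEq nat nat
  | Rel 'p nat
  | NRel 'p nat
  | Conj "'p fo" "'p fo"
  | Disj "'p fo" "'p fo"
  | Exists nat "'p fo"
  | Forall nat "'p fo"

primrec sat :: "nat \<Rightarrow> ('p \<Rightarrow> nat set) \<Rightarrow> (nat \<Rightarrow> nat) \<Rightarrow> 'p fo \<Rightarrow> bool" where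
  "sat n M s (Eq x y) \<longleftrightarrow> s x = s y"
| "sat n M s (NEq x y) \<longleftrightarrow> s x \<noteq> s y"
| "sat n M s (Rel P x) \<longleftrightarrow> s x \<in> M P"
| "sat n M s (NRel P x) \<longleftrightarrow> s x \<notin> M P"
| "sat n M s (Conj \<phi> \<psi>) \<longleftrightarrow> sat n M s \<phi> \<and> sat n M s \<psi>"
| "sat n M s (Disj \<phi> \<psi>) \<longleftrightarrow> sat n M s \<phi> \<or> sat n M s \<psi>"
| "sat n M s (Exists x \<phi>) \<longleftrightarrow> (\<exists>a\<in>{1..n}. sat n M (s(x := a)) \<phi>)"
| "sat n M s (Forall x \<phi>) \<longleftrightarrow> (\<forall>a\<in>{1..n}. sat n M (s(x := a)) \<phi>)"

primrec free_vars :: "'p fo \<Rightarrow> nat set" where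
  "free_vars (Eq x y) = {x, y}"
| "free_vars (NEq x y) = {x, y}"
| "free_vars (Rel P x) = {x}"
| "free_vars (NRel P x) = {x}"
| "free_vars (Conj \<phi> \<psi>) = free_vars \<phi> \<union> free_vars \<psi>"
| "free_vars (Disj \<phi> \<psi>) = free_vars \<phi> \<union> free_vars \<psi>"
| "free_vars (Exists x \<phi>) = free_vars \<phi> - {x}"
| "free_vars (Forall x \<phi>) = free_vars \<phi> - {x}"

primrec quantifier_rank :: "'p fo \<Rightarrow> nat" where
  "quantifier_rank (Eq x y) = 0"
| "quantifier_rank (NEq x y) = 0"
| "quantifier_rank (Rel P x) = 0"
| "quantifier_rank (NRel P x) = 0"
| "quantifier_rank (Conj \<phi> \<psi>) = max (quantifier_rank \<phi>) (quantifier_rank \<psi>)"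
| "quantifier_rank (Disj \<phi> \<psi>) = max (quantifier_rank \<phi>) (quantifier_rank \<psi>)"
| "quantifier_rank (Exists x \<phi>) = quantifier_rank \<phi> + 1"
| "quantifier_rank (Forall x \<phi>) = quantifier_rank \<phi> + 1"

primrec formula_size :: "'p fo \<Rightarrow> nat" where
  "formula_size (Eq x y) = 1"
| "formula_size (NEq x y) = 1"
| "formula_size (Rel P x) = 1"
| "formula_size (NRel P x) = 1"
| "formula_size (Conj \<phi> \<psi>) = formula_size \<phi> + formula_size \<psi> + 1"
| "formula_size (Disj \<phi> \<psi>) = formula_size \<phi> + formula_size \<psi> + 1"
| "formula_size (Exists x \<phi>) = formula_size \<phi> + 1"
| "formula_size (Forall x \<phi>) = formula_size \<phi> + 1"

text \<open>\<open>set_fo \<phi>\<close> is the set of relation symbols occurring in \<open>\<phi>\<close>.\<close>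

definition FO_sentences :: "'p set \<Rightarrow> nat \<Rightarrow> 'p fo set" where
  "FO_sentences \<tau> d = {\<phi>. set_fo \<phi> \<subseteq> \<tau> \<and> quantifier_rank \<phi> \<le> d \<and> free_vars \<phi> = {}}"

text \<open>Used for sentences only, whose truth value does not depend on the assignment \<open>s\<close>.\<close>

definition true_in :: "nat \<Rightarrow> ('p \<Rightarrow> nat set) \<Rightarrow> 'p fo \<Rightarrow> bool" where
  "true_in n M \<phi> \<longleftrightarrow> (\<forall>s. sat n M s \<phi>)"

definition defines_class :: "'p set \<Rightarrow> nat \<Rightarrow> nat \<Rightarrow> ('p \<Rightarrow> nat set) \<Rightarrow> 'p fo \<Rightarrow> bool" where
  "defines_class \<tau> n d M \<phi> \<longleftrightarrow> {M' \<in> models \<tau> n. true_in n M' \<phi>} = equiv_class \<tau> n d M"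

text \<open>
  For finite \<open>\<tau>\<close> and \<open>d \<ge> 1\<close> the minimum is over a nonempty set: ``exactly \<open>k\<close> points of
  type \<open>\<pi>\<close>'' for \<open>k < d\<close> and ``at least \<open>d\<close> points of type \<open>\<pi>\<close>'' have quantifier rank
  at most \<open>d\<close>.
\<close>

definition description_complexity :: "'p set \<Rightarrow> nat \<Rightarrow> nat \<Rightarrow> ('p \<Rightarrow> nat set) \<Rightarrow> nat" where
  "description_complexity \<tau> n d M =
     (LEAST k. \<exists>\<phi>\<in>FO_sentences \<tau> d. defines_class \<tau> n d M \<phi> \<and> formula_size \<phi> = k)"

text \<open>Meant for lists \<open>ks\<close> whose entries add up to \<open>n\<close>.\<close>

definition multinomial :: "nat \<Rightarrow> nat list \<Rightarrow> real" where
  "multinomial n ks = fact n / (\<Prod>k\<leftarrow>ks. fact k)"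

end

theory Submission
  imports Defs "HOL-Combinatorics.Multiset_Permutations"
begin

text \<open>
  If at most one type had more than \<open>h\<close> points, the class would consist of the models with the type
  counts of \<open>M\<close>, too few for its entropy. So two types have more than \<open>h\<close> points, and moving
  all but \<open>h\<close> of the points of one to the other yields a model outside the class.

  A defining sentence tells the two models apart. Let its equality atoms span a graph on the variable
  names. If every connected component had at most \<open>h\<close> names, a back-and-forth argument that
  matches equalities only within components would show that the sentence cannot distinguish the
  models. A component with \<open>h + 1\<close> names needs \<open>h\<close> equality atoms and \<open>h + 1\<close>
  quantifiers, and connectives then bring the size to at least \<open>3 h\<close>.
\<close>

subsection \<open>Sentences with few equality atoms\<close>

abbreviation point_type :: "'p set \<Rightarrow> ('p \<Rightarrow> nat set) \<Rightarrow> nat \<Rightarrow> 'p set" where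
  "point_type \<tau> M a \<equiv> {P \<in> \<tau>. a \<in> M P}"

text \<open>This is \<open>equiv_d\<close> with threshold \<open>h\<close> in place of
  \<open>d\<close>, put as a disjunction so that a proof can split on it.\<close>

definition similar :: "'p set \<Rightarrow> nat \<Rightarrow> nat \<Rightarrow> ('p \<Rightarrow> nat set) \<Rightarrow> ('p \<Rightarrow> nat set) \<Rightarrow> bool" where
  "similar \<tau> n h A B \<longleftrightarrow>
     (\<forall>\<pi>\<subseteq>\<tau>. type_count \<tau> n A \<pi> = type_count \<tau> n B \<pi> \<or>
        h \<le> type_count \<tau> n A \<pi> \<and> h \<le> type_count \<tau> n B \<pi>)"

text \<open>
  Unlike in an Ehrenfeucht-Fraisse position, equalities have to match only between variables that
  are related by \<open>R\<close>.
\<close>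

definition matching ::
    "'p set \<Rightarrow> nat \<Rightarrow> nat rel \<Rightarrow> ('p \<Rightarrow> nat set) \<Rightarrow> ('p \<Rightarrow> nat set) \<Rightarrow> (nat \<Rightarrow> nat) \<Rightarrow> (nat \<Rightarrow> nat) \<Rightarrow> bool"
  where "matching \<tau> n R A B s s' \<longleftrightarrow>
     (\<forall>x. s x \<in> {1..n} \<and> s' x \<in> {1..n} \<and> point_type \<tau> A (s x) = point_type \<tau> B (s' x)) \<and>
     (\<forall>(x, y)\<in>R. s x = s y \<longleftrightarrow> s' x = s' y)"

section \<open>Back-and-forth between similar models\<close>

lemma similar_sym: "similar \<tau> n h A B \<Longrightarrow> similar \<tau> n h B A"
  unfolding similar_def by (auto simp: eq_commute)

lemma matching_sym: "matching \<tau> n R A B s s' \<Longrightarrow> matching \<tau> n R B A s' s"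
  unfolding matching_def by auto

text \<open>On \<open>U\<close> the value of \<open>f\<close> determines that of \<open>g\<close>,
  so choosing a preimage for each value of \<open>f\<close> exhibits the second image as an image of
  the first.\<close>

lemma card_image_le_if_factors:
  assumes "finite U" and "\<And>z w. z \<in> U \<Longrightarrow> w \<in> U \<Longrightarrow> f z = f w \<Longrightarrow> g z = g w"
  shows "card (g ` U) \<le> card (f ` U)"
proof -
  have "g z = g (inv_into U f (f z))" if "z \<in> U" for z
    by (rule assms(2)) (use that in \<open>auto simp: inv_into_into f_inv_into_f\<close>)
  then have eq: "g ` U = (\<lambda>a. g (inv_into U f a)) ` f ` U"
    by (force simp: image_image)
  show ?thesis
    unfolding eq by (rule card_image_le) (use assms(1) in simp)
qed

text \<open>The answer \<open>b\<close> is constrained only by the other names in the class of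
  \<open>x\<close>. If one of them already denotes \<open>a\<close>, its partner is the answer.
  Otherwise a point of the type of \<open>a\<close> is needed that these names do not denote in
  \<open>B\<close>, and a count shows that one is left.\<close>

lemma matching_extend:
  assumes sim: "similar \<tau> n h A B" and R: "sym R" "trans R"
    and fin: "finite (R `` {x})" and le: "card (R `` {x}) \<le> h" and x: "(x, x) \<in> R"
    and m: "matching \<tau> n R A B s s'" and a: "a \<in> {1..n}"
  obtains b where "b \<in> {1..n}" "matching \<tau> n R A B (s(x := a)) (s'(x := b))"
proof -
  \<comment> \<open>The old value of \<open>x\<close> is overwritten, so \<open>x\<close> itself
    imposes no constraint.\<close>
  define Y where "Y = R `` {x} - {x}"
  have tp: "s y \<in> {1..n}" "s' y \<in> {1..n}" "point_type \<tau> A (s y) = point_type \<tau> B (s' y)" for y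
    using m unfolding matching_def by blast+
  have eqR: "s y = s z \<longleftrightarrow> s' y = s' z" if "(y, z) \<in> R" for y z
    using m that unfolding matching_def by blast
  have YR: "(y, z) \<in> R" if "y \<in> Y" "z \<in> Y" for y z
    using that transD[OF R(2) symD[OF R(1)], of x y z] unfolding Y_def by blast
  have "\<exists>b\<in>{1..n}. point_type \<tau> B b = point_type \<tau> A a \<and> (\<forall>y\<in>Y. s y = a \<longleftrightarrow> s' y = b)"
  proof (cases "\<exists>y\<in>Y. s y = a")
    case True
    then obtain y where y: "y \<in> Y" "s y = a" by blast
    then have "\<forall>z\<in>Y. s z = a \<longleftrightarrow> s' z = s' y"
      using eqR YR by metis
    then show ?thesis using tp[of y] y by auto
  next
    case False
    define \<pi> where "\<pi> = point_type \<tau> A a"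
    define U where "U = {z \<in> Y. point_type \<tau> A (s z) = \<pi>}"
    have finY: "finite Y" using fin by (simp add: Y_def)
    \<comment> \<open>Reflexivity at \<open>x\<close> makes the inclusion strict and thus gives
      \<open>card Y < h\<close>, not merely \<open>card Y \<le> h\<close>.\<close>
    have "Y \<subset> R `` {x}" using x by (auto simp: Y_def)
    then have cY: "card Y < h" using psubset_card_mono[OF fin] le by (meson less_le_trans)
    have finU: "finite U" unfolding U_def using finY by simp
    have le: "card (s' ` U) \<le> card (s ` U)"
      using finU by (rule card_image_le_if_factors) (use eqR YR in \<open>auto simp: U_def\<close>)
    have "s ` U \<subseteq> {c \<in> {1..n}. point_type \<tau> A c = \<pi>}"
      using tp(1) unfolding U_def by blast
    moreover have "a \<in> {c \<in> {1..n}. point_type \<tau> A c = \<pi>} - s ` U"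
      using False a unfolding U_def \<pi>_def by blast
    ultimately have "s ` U \<subset> {c \<in> {1..n}. point_type \<tau> A c = \<pi>}" by blast
    then have "card (s ` U) < type_count \<tau> n A \<pi>"
      unfolding type_count_def by (intro psubset_card_mono) auto
    with le have 1: "card (s' ` U) < type_count \<tau> n A \<pi>" by simp
    \<comment> \<open>Each alternative of \<open>similar\<close> has its own bound on the occupied
      points: \<open>1\<close> serves when the two counts agree, and \<open>card Y < h\<close> when
      both are at least \<open>h\<close>.\<close>
    have "card (s' ` U) \<le> card Y"
      using finY by (intro order.trans[OF card_image_le[OF finU] card_mono]) (auto simp: U_def)
    then have "card (s' ` U) < type_count \<tau> n B \<pi>"
      using 1 cY sim[unfolded similar_def, rule_format, of \<pi>] by (auto simp: \<pi>_def)
    then have "\<not> {c \<in> {1..n}. point_type \<tau> B c = \<pi>} \<subseteq> s' ` U"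
      using card_mono[of "s' ` U"] finU unfolding type_count_def by (meson finite_imageI not_less)
    then obtain b where "b \<in> {1..n}" "point_type \<tau> B b = \<pi>" "b \<notin> s' ` U" by blast
    then show ?thesis
      using False tp(3) unfolding U_def \<pi>_def by (intro bexI[of _ b]) auto
  qed
  then obtain b where b: "b \<in> {1..n}" "point_type \<tau> B b = point_type \<tau> A a"
    "\<forall>y\<in>Y. s y = a \<longleftrightarrow> s' y = b" by blast
  have "(s(x := a)) y = (s(x := a)) z \<longleftrightarrow> (s'(x := b)) y = (s'(x := b)) z" if "(y, z) \<in> R" for y z
    using that symD[OF R(1) that] eqR[of y z] b(3) by (auto simp: Y_def)
  moreover have "(s(x := a)) y \<in> {1..n} \<and> (s'(x := b)) y \<in> {1..n} \<and>
      point_type \<tau> A ((s(x := a)) y) = point_type \<tau> B ((s'(x := b)) y)" for y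
    using tp[of y] b(1,2) a by (simp only: fun_upd_apply split: if_split) blast
  ultimately have "matching \<tau> n R A B (s(x := a)) (s'(x := b))"
    unfolding matching_def by blast
  with b(1) that show thesis by blast
qed

text \<open>These are the edges of a graph on names, regardless of which quantifier binds an
  occurrence; hence one relation \<open>R\<close> serves all subformulas. Repeated atoms give a
  single edge, which is harmless for a lower bound on size.\<close>

primrec equality_pairs :: "'p fo \<Rightarrow> nat rel" where
  "equality_pairs (Eq x y) = {(x, y)}"
| "equality_pairs (NEq x y) = {(x, y)}"
| "equality_pairs (Rel P x) = {}"
| "equality_pairs (NRel P x) = {}"
| "equality_pairs (Conj \<phi> \<psi>) = equality_pairs \<phi> \<union> equality_pairs \<psi>"
| "equality_pairs (Disj \<phi> \<psi>) = equality_pairs \<phi> \<union> equality_pairs \<psi>"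
| "equality_pairs (Exists x \<phi>) = equality_pairs \<phi>"
| "equality_pairs (Forall x \<phi>) = equality_pairs \<phi>"

primrec bound_vars :: "'p fo \<Rightarrow> nat set" where
  "bound_vars (Eq x y) = {}"
| "bound_vars (NEq x y) = {}"
| "bound_vars (Rel P x) = {}"
| "bound_vars (NRel P x) = {}"
| "bound_vars (Conj \<phi> \<psi>) = bound_vars \<phi> \<union> bound_vars \<psi>"
| "bound_vars (Disj \<phi> \<psi>) = bound_vars \<phi> \<union> bound_vars \<psi>"
| "bound_vars (Exists x \<phi>) = insert x (bound_vars \<phi>)"
| "bound_vars (Forall x \<phi>) = insert x (bound_vars \<phi>)"

lemma finite_equality_pairs: "finite (equality_pairs \<phi>)"
  by (induction \<phi>) auto

lemma finite_bound_vars: "finite (bound_vars \<phi>)"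
  by (induction \<phi>) auto

lemma Field_equality_pairs: "Field (equality_pairs \<phi>) \<subseteq> free_vars \<phi> \<union> bound_vars \<phi>"
  by (induction \<phi>) auto

text \<open>A formula with \<open>m\<close> atoms has \<open>m - 1\<close> binary connectives.\<close>

lemma formula_size_ge:
  "2 * card (equality_pairs \<phi>) + card (bound_vars \<phi>) \<le> formula_size \<phi> + 1"
proof (induction \<phi>)
  case (Conj \<phi> \<psi>)
  then show ?case
    using card_Un_le[of "equality_pairs \<phi>" "equality_pairs \<psi>"]
      card_Un_le[of "bound_vars \<phi>" "bound_vars \<psi>"] by simp
next
  case (Disj \<phi> \<psi>)
  then show ?case
    using card_Un_le[of "equality_pairs \<phi>" "equality_pairs \<psi>"]
      card_Un_le[of "bound_vars \<phi>" "bound_vars \<psi>"] by simp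
qed (auto simp: card_insert_if finite_bound_vars)

text \<open>The invariant \<open>matching\<close> survives every quantifier, since assigning a name
  again frees its old value. What has to be bounded is thus the size of the classes of
  \<open>R\<close>; the quantifier rank does not enter.\<close>

lemma sat_matching:
  assumes "similar \<tau> n h A B" "sym R" "trans R"
    and "\<And>x. (x, x) \<in> R" "\<And>x. finite (R `` {x})" "\<And>x. card (R `` {x}) \<le> h"
    and "set_fo \<phi> \<subseteq> \<tau>" "equality_pairs \<phi> \<subseteq> R" "matching \<tau> n R A B s s'"
  shows "sat n A s \<phi> \<longleftrightarrow> sat n B s' \<phi>"
proof -
  have extend: "\<exists>b\<in>{1..n}. matching \<tau> n R A B (u(x := a)) (u'(x := b))"
    if "matching \<tau> n R A B u u'" "a \<in> {1..n}" for u u' x a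
    by (rule matching_extend[OF assms(1-3,5,6,4) that]) blast
  have extend': "\<exists>a\<in>{1..n}. matching \<tau> n R A B (u(x := a)) (u'(x := b))"
    if "matching \<tau> n R A B u u'" "b \<in> {1..n}" for u u' x b
    by (rule matching_extend[OF similar_sym[OF assms(1)] assms(2,3,5,6,4)
        matching_sym[OF that(1)] that(2)]) (blast intro: matching_sym)
  show ?thesis
    using assms(7-9)
  proof (induction \<phi> arbitrary: s s')
    case (Exists x \<phi>)
    have IH: "sat n A u \<phi> \<longleftrightarrow> sat n B u' \<phi>" if "matching \<tau> n R A B u u'" for u u'
      using Exists that by simp
    show ?case
      unfolding sat.simps
    proof
      assume "\<exists>a\<in>{1..n}. sat n A (s(x := a)) \<phi>"
      then obtain a where a: "a \<in> {1..n}" "sat n A (s(x := a)) \<phi>" by blast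
      from extend[OF Exists.prems(3) a(1)] a(2) IH
      show "\<exists>b\<in>{1..n}. sat n B (s'(x := b)) \<phi>" by blast
    next
      assume "\<exists>b\<in>{1..n}. sat n B (s'(x := b)) \<phi>"
      then obtain b where b: "b \<in> {1..n}" "sat n B (s'(x := b)) \<phi>" by blast
      from extend'[OF Exists.prems(3) b(1)] b(2) IH
      show "\<exists>a\<in>{1..n}. sat n A (s(x := a)) \<phi>" by blast
    qed
  next
    case (Forall x \<phi>)
    have IH: "sat n A u \<phi> \<longleftrightarrow> sat n B u' \<phi>" if "matching \<tau> n R A B u u'" for u u'
      using Forall that by simp
    show ?case
      unfolding sat.simps
    proof (intro iffI ballI)
      fix b assume "\<forall>a\<in>{1..n}. sat n A (s(x := a)) \<phi>" and b: "b \<in> {1..n}"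
      then show "sat n B (s'(x := b)) \<phi>"
        using extend'[OF Forall.prems(3) b] IH by blast
    next
      fix a assume "\<forall>b\<in>{1..n}. sat n B (s'(x := b)) \<phi>" and a: "a \<in> {1..n}"
      then show "sat n A (s(x := a)) \<phi>"
        using extend[OF Forall.prems(3) a] IH by blast
    qed
  next
    case (Rel P x)
    then have "P \<in> point_type \<tau> A (s x) \<longleftrightarrow> P \<in> point_type \<tau> B (s' x)"
      unfolding matching_def by blast
    with Rel show ?case by simp
  next
    case (NRel P x)
    then have "P \<in> point_type \<tau> A (s x) \<longleftrightarrow> P \<in> point_type \<tau> B (s' x)"
      unfolding matching_def by blast
    with NRel show ?case by simp
  next
    case (Conj \<phi>1 \<phi>2)
    then have "sat n A s \<phi>1 = sat n B s' \<phi>1" "sat n A s \<phi>2 = sat n B s' \<phi>2" by auto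
    then show ?case by simp
  next
    case (Disj \<phi>1 \<phi>2)
    then have "sat n A s \<phi>1 = sat n B s' \<phi>1" "sat n A s \<phi>2 = sat n B s' \<phi>2" by auto
    then show ?case by simp
  qed (auto simp: matching_def)
qed

text \<open>Among the sets \<open>S\<close> containing \<open>x\<close> with at least
  \<open>card S - 1\<close> edges inside, one of largest size is closed under neighbours, because a
  new vertex brings a new edge. It therefore contains the component.\<close>

lemma card_connected_component:
  fixes G :: "'a rel"
  assumes G: "finite G"
  shows "finite ((G \<union> G\<inverse>)\<^sup>* `` {x}) \<and> card ((G \<union> G\<inverse>)\<^sup>* `` {x}) \<le> card G + 1"
proof -
  define F where "F = insert x (Field G)"
  \<comment> \<open>The bound \<open>F\<close> leaves finitely many candidates, so a largest one
    exists.\<close>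
  define P where "P = (\<lambda>S. x \<in> S \<and> S \<subseteq> F \<and> card S \<le> card (G \<inter> S \<times> S) + 1)"
  have finF: "finite F" using G by (simp add: F_def finite_Field)
  have "\<exists>S. P S \<and> (\<forall>T. P T \<longrightarrow> card T \<le> card S)"
  proof (rule Lattices_Big.ex_has_greatest_nat)
    show "P {x}" by (simp add: P_def F_def)
    show "\<forall>T. P T \<longrightarrow> card T < Suc (card F)"
      using finF by (simp add: P_def card_mono less_Suc_eq_le)
  qed
  then obtain S where S: "P S" and max: "\<And>T. P T \<Longrightarrow> card T \<le> card S" by blast
  have finS: "finite S" using S finF by (auto simp: P_def intro: finite_subset)
  have closed: "v \<in> S" if u: "u \<in> S" and uv: "(u, v) \<in> G \<union> G\<inverse>" for u v
  proof (rule ccontr)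
    assume v: "v \<notin> S"
    from uv obtain e where e: "e \<in> G" "e = (u, v) \<or> e = (v, u)" by auto
    \<comment> \<open>The edge \<open>e\<close> leaves \<open>S\<close>, so it was not counted
      before, but it lies inside \<open>insert v S\<close>.\<close>
    have "insert e (G \<inter> S \<times> S) \<subseteq> G \<inter> insert v S \<times> insert v S"
      using e u by auto
    then have "card (insert e (G \<inter> S \<times> S)) \<le> card (G \<inter> insert v S \<times> insert v S)"
      using G by (intro card_mono) auto
    moreover have "e \<notin> G \<inter> S \<times> S" using e(2) v by auto
    ultimately have "card (G \<inter> S \<times> S) + 1 \<le> card (G \<inter> insert v S \<times> insert v S)"
      using G by simp
    moreover have "insert v S \<subseteq> F"
      using S e by (auto simp: P_def F_def Field_def)
    ultimately have "P (insert v S)"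
      using S v finS by (auto simp: P_def)
    from max[OF this] v finS show False by simp
  qed
  have "(x, y) \<in> (G \<union> G\<inverse>)\<^sup>* \<Longrightarrow> y \<in> S" for y
    by (induction rule: rtrancl_induct) (use S closed in \<open>auto simp: P_def\<close>)
  then have sub: "(G \<union> G\<inverse>)\<^sup>* `` {x} \<subseteq> S" by auto
  have "card (G \<inter> S \<times> S) \<le> card G" using G by (intro card_mono) auto
  then have "card S \<le> card G + 1" using S by (simp add: P_def)
  then show ?thesis
    using sub finS card_mono[OF finS sub] by (auto intro: finite_subset)
qed

section \<open>Size of sentences that separate similar models\<close>

lemma sat_cong_free_vars:
  "(\<And>x. x \<in> free_vars \<phi> \<Longrightarrow> s x = s' x) \<Longrightarrow> sat n M s \<phi> \<longleftrightarrow> sat n M s' \<phi>"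
proof (induction \<phi> arbitrary: s s')
  case (Conj \<phi> \<psi>)
  have "sat n M s \<phi> = sat n M s' \<phi>" "sat n M s \<psi> = sat n M s' \<psi>"
    by (rule Conj.IH, use Conj.prems in simp)+
  then show ?case by simp
next
  case (Disj \<phi> \<psi>)
  have "sat n M s \<phi> = sat n M s' \<phi>" "sat n M s \<psi> = sat n M s' \<psi>"
    by (rule Disj.IH, use Disj.prems in simp)+
  then show ?case by simp
next
  case (Exists x \<phi>)
  have "sat n M (s(x := a)) \<phi> = sat n M (s'(x := a)) \<phi>" for a
    by (rule Exists.IH) (use Exists.prems in auto)
  then show ?case by simp
next
  case (Forall x \<phi>)
  have "sat n M (s(x := a)) \<phi> = sat n M (s'(x := a)) \<phi>" for a
    by (rule Forall.IH) (use Forall.prems in auto)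
  then show ?case by simp
qed auto

lemma true_in_iff_sat:
  assumes "free_vars \<phi> = {}"
  shows "true_in n M \<phi> \<longleftrightarrow> sat n M s \<phi>"
proof -
  have "sat n M s' \<phi> \<longleftrightarrow> sat n M s \<phi>" for s'
    by (rule sat_cong_free_vars) (simp add: assms)
  then show ?thesis unfolding true_in_def by blast
qed

text \<open>By \<open>sat_matching\<close> some component has at least \<open>h + 1\<close> names.
  They are all bound and come with at least \<open>h\<close> edges, so
  \<open>formula_size_ge\<close> gives
  \<open>2 * h + (h + 1) \<le> formula_size \<phi> + 1\<close>.\<close>

lemma formula_size_ge_if_distinguishes:
  assumes sim: "similar \<tau> n h A B" and h: "h \<ge> 1"
    and \<phi>: "set_fo \<phi> \<subseteq> \<tau>" "free_vars \<phi> = {}" "true_in n A \<phi>" "\<not> true_in n B \<phi>"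
    and a: "a \<in> {1..n}" and b: "b \<in> {1..n}" and ab: "point_type \<tau> A a = point_type \<tau> B b"
  shows "formula_size \<phi> \<ge> 3 * h"
proof -
  define G where "G = equality_pairs \<phi>"
  define R where "R = (G \<union> G\<inverse>)\<^sup>*"
  have comp: "finite (R `` {x})" "card (R `` {x}) \<le> card G + 1" for x
    using card_connected_component[of G x] finite_equality_pairs[of \<phi>]
    unfolding R_def G_def by blast+
  have "sym R" "trans R" "\<And>x. (x, x) \<in> R"
    unfolding R_def by (auto intro: sym_rtrancl simp: sym_Un_converse trans_rtrancl)
  moreover have "equality_pairs \<phi> \<subseteq> R" unfolding R_def G_def by auto
  \<comment> \<open>Constant assignments make every equality true on both sides, so two points of
    equal type suffice for a start.\<close>
  moreover have "matching \<tau> n R A B (\<lambda>_. a) (\<lambda>_. b)"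
    using a b ab unfolding matching_def by auto
  moreover have "sat n A (\<lambda>_. a) \<phi> \<noteq> sat n B (\<lambda>_. b) \<phi>"
    using \<phi>(3,4) true_in_iff_sat[OF \<phi>(2)] by blast
  ultimately have "\<not> (\<forall>x. card (R `` {x}) \<le> h)"
    using sat_matching[OF sim _ _ _ comp(1) _ \<phi>(1)] by blast
  then obtain x where x: "card (R `` {x}) > h" by (auto simp: not_le)
  have G: "card G \<ge> h" using x comp(2)[of x] by linarith
  have "R `` {x} \<subseteq> Field G"
  proof (cases "x \<in> Field G")
    case True
    have "(x, y) \<in> R \<Longrightarrow> y \<in> Field G" for y
      unfolding R_def by (induction rule: rtrancl_induct) (use True in \<open>auto simp: Field_def\<close>)
    then show ?thesis by auto
  next
    case False
    \<comment> \<open>A name in no equality atom is a component by itself, too small because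
      \<open>h \<ge> 1\<close>.\<close>
    have "(x, y) \<in> R \<Longrightarrow> y = x" for y
      unfolding R_def by (induction rule: rtrancl_induct) (use False in \<open>auto simp: Field_def\<close>)
    then have "R `` {x} \<subseteq> {x}" by auto
    from card_mono[OF _ this] x h show ?thesis by simp
  qed
  also have "\<dots> \<subseteq> bound_vars \<phi>"
    using Field_equality_pairs[of \<phi>] \<phi>(2) by (simp add: G_def)
  finally have "card (R `` {x}) \<le> card (bound_vars \<phi>)"
    by (intro card_mono finite_bound_vars)
  with x G formula_size_ge[of \<phi>] show ?thesis unfolding G_def by linarith
qed

section \<open>Moving points between two large types\<close>

text \<open>All but \<open>h\<close> points of \<open>\<pi>1\<close> are given the type
  \<open>\<pi>2\<close>. Both types had at least \<open>h\<close> points and still do, and the other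
  counts stay fixed, so similarity holds.\<close>

lemma exists_similar_model:
  assumes M: "M \<in> models \<tau> n" and \<pi>: "\<pi>1 \<noteq> \<pi>2" "\<pi>1 \<subseteq> \<tau>" "\<pi>2 \<subseteq> \<tau>"
    and h: "h \<le> type_count \<tau> n M \<pi>1" "h \<le> type_count \<tau> n M \<pi>2"
  obtains B where "B \<in> models \<tau> n" "similar \<tau> n h M B" "type_count \<tau> n B \<pi>1 = h"
proof -
  define T where "T = (\<lambda>N \<pi>. {a \<in> {1..n}. point_type \<tau> N a = \<pi>})"
  have T: "finite (T N \<pi>)" "type_count \<tau> n N \<pi> = card (T N \<pi>)" for N \<pi>
    unfolding T_def type_count_def by auto
  obtain X where X: "X \<subseteq> T M \<pi>1" "card X = card (T M \<pi>1) - h"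
    using obtain_subset_with_card_n[of "card (T M \<pi>1) - h" "T M \<pi>1"] by auto
  \<comment> \<open>On \<open>X\<close> exactly the symbols of \<open>\<pi>2\<close> hold. The value
    \<open>undefined\<close> keeps \<open>B\<close> extensional, as membership in
    \<open>models\<close> requires.\<close>
  define B where
    "B = (\<lambda>P. if P \<in> \<tau> then (if P \<in> \<pi>2 then M P \<union> X else M P - X) else undefined)"
  have "X \<subseteq> {1..n}" using X(1) unfolding T_def by auto
  then have B: "B \<in> models \<tau> n"
    using M unfolding models_def B_def by (auto simp: PiE_iff extensional_def)
  have pt: "point_type \<tau> B a = (if a \<in> X then \<pi>2 else point_type \<tau> M a)" for a
    using \<pi>(3) unfolding B_def by auto
  have 1: "T B \<pi>1 = T M \<pi>1 - X" using \<pi>(1) unfolding T_def pt by auto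
  have 2: "T M \<pi>2 \<subseteq> T B \<pi>2" unfolding T_def pt by auto
  have 3: "T B \<pi> = T M \<pi>" if "\<pi> \<noteq> \<pi>1" "\<pi> \<noteq> \<pi>2" for \<pi>
    using that X(1) unfolding T_def pt by auto
  have c1: "card (T B \<pi>1) = h"
    unfolding 1 using X h(1) T by (subst card_Diff_subset) (auto intro: finite_subset)
  have c2: "h \<le> card (T B \<pi>2)"
    using h(2) card_mono[OF T(1) 2] unfolding T(2) by linarith
  have "similar \<tau> n h M B"
    unfolding similar_def T(2)
  proof (intro allI impI)
    fix \<pi>
    show "card (T M \<pi>) = card (T B \<pi>) \<or> h \<le> card (T M \<pi>) \<and> h \<le> card (T B \<pi>)"
      using c1 c2 3[of \<pi>] h[unfolded T(2)] by (cases "\<pi> = \<pi>1"; cases "\<pi> = \<pi>2") auto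
  qed
  with B c1 that show thesis unfolding T(2) by blast
qed

subsection \<open>Definability of the equivalence classes\<close>

text \<open>This section only shows that the minimum in \<open>description_complexity\<close> is
  attained. Hence free names and rank are tracked, but not size, and properties of models stand in
  for explicit formulas.\<close>

definition definable ::
    "'p set \<Rightarrow> nat \<Rightarrow> nat set \<Rightarrow> nat \<Rightarrow> (('p \<Rightarrow> nat set) \<Rightarrow> (nat \<Rightarrow> nat) \<Rightarrow> bool) \<Rightarrow> bool"
  where "definable \<tau> n V r Q \<longleftrightarrow>
    (\<exists>\<phi>. set_fo \<phi> \<subseteq> \<tau> \<and> free_vars \<phi> \<subseteq> V \<and> quantifier_rank \<phi> \<le> r \<and>
      (\<forall>N s. sat n N s \<phi> \<longleftrightarrow> Q N s))"

lemma definableI: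
  assumes "set_fo \<phi> \<subseteq> \<tau>" "free_vars \<phi> \<subseteq> V" "quantifier_rank \<phi> \<le> r"
    and "\<And>N s. sat n N s \<phi> \<longleftrightarrow> Q N s"
  shows "definable \<tau> n V r Q"
  using assms unfolding definable_def by blast

lemma definable_cong:
  "definable \<tau> n V r Q \<Longrightarrow> (\<And>N s. Q N s \<longleftrightarrow> Q' N s) \<Longrightarrow> definable \<tau> n V r Q'"
  unfolding definable_def by simp

lemma definable_mono:
  "definable \<tau> n V r Q \<Longrightarrow> V \<subseteq> V' \<Longrightarrow> r \<le> r' \<Longrightarrow> definable \<tau> n V' r' Q"
  unfolding definable_def by (meson order_trans)

text \<open>Negation is not a constructor, so it is pushed to the atoms, at no cost in rank.\<close>

primrec dual :: "'p fo \<Rightarrow> 'p fo" where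
  "dual (Eq x y) = NEq x y"
| "dual (NEq x y) = Eq x y"
| "dual (Rel P x) = NRel P x"
| "dual (NRel P x) = Rel P x"
| "dual (Conj \<phi> \<psi>) = Disj (dual \<phi>) (dual \<psi>)"
| "dual (Disj \<phi> \<psi>) = Conj (dual \<phi>) (dual \<psi>)"
| "dual (Exists x \<phi>) = Forall x (dual \<phi>)"
| "dual (Forall x \<phi>) = Exists x (dual \<phi>)"

lemma dual_simps [simp]:
  "set_fo (dual \<phi>) = set_fo \<phi>"
  "free_vars (dual \<phi>) = free_vars \<phi>"
  "quantifier_rank (dual \<phi>) = quantifier_rank \<phi>"
  by (induction \<phi>) auto

lemma sat_dual [simp]: "sat n N s (dual \<phi>) \<longleftrightarrow> \<not> sat n N s \<phi>"
  by (induction \<phi> arbitrary: s) auto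

lemma definable_not:
  assumes "definable \<tau> n V r Q"
  shows "definable \<tau> n V r (\<lambda>N s. \<not> Q N s)"
proof -
  from assms obtain \<phi> where "set_fo \<phi> \<subseteq> \<tau>" "free_vars \<phi> \<subseteq> V" "quantifier_rank \<phi> \<le> r"
    "\<And>N s. sat n N s \<phi> \<longleftrightarrow> Q N s" unfolding definable_def by blast
  then show ?thesis by (intro definableI[of "dual \<phi>"]) auto
qed

lemma definable_conj:
  assumes "definable \<tau> n V r Q" "definable \<tau> n V r Q'"
  shows "definable \<tau> n V r (\<lambda>N s. Q N s \<and> Q' N s)"
proof -
  from assms(1) obtain \<phi> where "set_fo \<phi> \<subseteq> \<tau>" "free_vars \<phi> \<subseteq> V" "quantifier_rank \<phi> \<le> r"
    "\<And>N s. sat n N s \<phi> \<longleftrightarrow> Q N s" unfolding definable_def by blast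
  moreover from assms(2) obtain \<psi> where "set_fo \<psi> \<subseteq> \<tau>" "free_vars \<psi> \<subseteq> V"
    "quantifier_rank \<psi> \<le> r" "\<And>N s. sat n N s \<psi> \<longleftrightarrow> Q' N s" unfolding definable_def by blast
  ultimately show ?thesis by (intro definableI[of "Conj \<phi> \<psi>"]) auto
qed

lemma definable_Bex:
  assumes "definable \<tau> n (insert x V) r Q"
  shows "definable \<tau> n V (Suc r) (\<lambda>N s. \<exists>a\<in>{1..n}. Q N (s(x := a)))"
proof -
  from assms obtain \<phi> where "set_fo \<phi> \<subseteq> \<tau>" "free_vars \<phi> \<subseteq> insert x V" "quantifier_rank \<phi> \<le> r"
    "\<And>N s. sat n N s \<phi> \<longleftrightarrow> Q N s" unfolding definable_def by blast
  then show ?thesis by (intro definableI[of "Exists x \<phi>"]) auto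
qed

text \<open>Truth is not an atom: a trivial equation needs a free name or a quantifier, whence the
  side condition here and in the lemmas built on it.\<close>

lemma definable_True:
  assumes "V \<noteq> {} \<or> r > 0"
  shows "definable \<tau> n V r (\<lambda>N s. True)"
proof (cases "V = {}")
  case True
  then show ?thesis
    using assms by (intro definableI[of "Forall 0 (Eq 0 0)"]) auto
next
  case False
  then obtain x where "x \<in> V" by blast
  then show ?thesis by (intro definableI[of "Eq x x"]) auto
qed

lemma definable_finite_Ball:
  assumes "V \<noteq> {} \<or> r > 0" "finite I" "\<And>i. i \<in> I \<Longrightarrow> definable \<tau> n V r (Q i)"
  shows "definable \<tau> n V r (\<lambda>N s. \<forall>i\<in>I. Q i N s)"
  using assms(2,3)
proof (induction I)
  case empty
  then show ?case using definable_True[OF assms(1)] by simp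
next
  case (insert i I)
  then have "definable \<tau> n V r (\<lambda>N s. Q i N s \<and> (\<forall>i\<in>I. Q i N s))"
    by (intro definable_conj) auto
  then show ?case by simp
qed

lemma definable_point_type:
  assumes "finite \<tau>" "\<pi> \<subseteq> \<tau>" "x \<in> V"
  shows "definable \<tau> n V r (\<lambda>N s. point_type \<tau> N (s x) = \<pi>)"
proof -
  have "definable \<tau> n V r (\<lambda>N s. \<forall>P\<in>\<tau>. P \<in> \<pi> \<longleftrightarrow> s x \<in> N P)"
  proof (rule definable_finite_Ball)
    fix P assume "P \<in> \<tau>"
    then show "definable \<tau> n V r (\<lambda>N s. P \<in> \<pi> \<longleftrightarrow> s x \<in> N P)"
      using assms(3)
      by (cases "P \<in> \<pi>") (auto intro: definableI[of "Rel P x"] definableI[of "NRel P x"])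
  qed (use assms in auto)
  then show ?thesis
    by (rule definable_cong) (use assms(2) in blast)
qed

text \<open>This is the recursion of \<open>definable_at_least\<close>: each unit of cardinality
  costs one quantifier.\<close>

lemma Suc_le_card_iff:
  assumes "finite D"
  shows "Suc m \<le> card D \<longleftrightarrow> (\<exists>a\<in>D. m \<le> card (D - {a}))"
proof
  assume le: "Suc m \<le> card D"
  then obtain a where "a \<in> D" by fastforce
  with le assms show "\<exists>a\<in>D. m \<le> card (D - {a})" by auto
next
  assume "\<exists>a\<in>D. m \<le> card (D - {a})"
  then obtain a where a: "a \<in> D" "m \<le> card (D - {a})" by blast
  have "card D = Suc (card (D - {a}))" using card.remove[OF assms a(1)] .
  with a(2) show "Suc m \<le> card D" by simp
qed

text \<open>The variables \<open>0, \<dots>, i - 1\<close> hold the points chosen so far.\<close>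

lemma definable_at_least:
  assumes \<tau>: "finite \<tau>" and \<pi>: "\<pi> \<subseteq> \<tau>" and "i > 0 \<or> m > 0"
  shows "definable \<tau> n {..<i} m
    (\<lambda>N s. m \<le> card ({a \<in> {1..n}. point_type \<tau> N a = \<pi>} - s ` {..<i}))"
  using assms(3)
proof (induction m arbitrary: i)
  case 0
  then have "{..<i} \<noteq> {}" by auto
  then show ?case using definable_True[of "{..<i}" 0 \<tau> n] by simp
next
  case (Suc m)
  let ?T = "\<lambda>N. {a \<in> {1..n}. point_type \<tau> N a = \<pi>}"
  have ne: "definable \<tau> n (insert i {..<i}) m (\<lambda>N s. \<forall>j\<in>{..<i}. s i \<noteq> s j)"
  proof (rule definable_finite_Ball)
    fix j assume "j \<in> {..<i}"
    then show "definable \<tau> n (insert i {..<i}) m (\<lambda>N s. s i \<noteq> s j)"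
      by (intro definableI[of "NEq i j"]) auto
  qed auto
  \<comment> \<open>Once the name \<open>i\<close> holds the new point, removing the values of the
    first \<open>Suc i\<close> names removes that point too.\<close>
  have IH: "definable \<tau> n (insert i {..<i}) m (\<lambda>N s. m \<le> card (?T N - s ` {..<Suc i}))"
    using Suc.IH[of "Suc i"] by (simp add: lessThan_Suc)
  have "definable \<tau> n {..<i} (Suc m) (\<lambda>N s. \<exists>a\<in>{1..n}.
      point_type \<tau> N ((s(i := a)) i) = \<pi> \<and> (\<forall>j\<in>{..<i}. (s(i := a)) i \<noteq> (s(i := a)) j) \<and>
      m \<le> card (?T N - (s(i := a)) ` {..<Suc i}))"
    using definable_Bex[OF definable_conj[OF definable_point_type[OF \<tau> \<pi> insertI1]
      definable_conj[OF ne IH]]] .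
  then show ?case
  proof (rule definable_cong)
    fix N :: "'a \<Rightarrow> nat set" and s :: "nat \<Rightarrow> nat"
    have im: "(s(i := a)) ` {..<Suc i} = insert a (s ` {..<i})" for a
      by (auto simp: lessThan_Suc image_iff)
    have ne: "(\<forall>j\<in>{..<i}. (s(i := a)) i \<noteq> (s(i := a)) j) \<longleftrightarrow> a \<notin> s ` {..<i}" for a
      by auto
    have "Suc m \<le> card (?T N - s ` {..<i}) \<longleftrightarrow>
        (\<exists>a\<in>?T N - s ` {..<i}. m \<le> card (?T N - s ` {..<i} - {a}))"
      by (rule Suc_le_card_iff) simp
    also have "\<dots> \<longleftrightarrow> (\<exists>a\<in>{1..n}. point_type \<tau> N a = \<pi> \<and> a \<notin> s ` {..<i} \<and>
        m \<le> card (?T N - insert a (s ` {..<i})))"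
      unfolding Diff_insert[symmetric] by blast
    finally show "(\<exists>a\<in>{1..n}. point_type \<tau> N ((s(i := a)) i) = \<pi> \<and>
        (\<forall>j\<in>{..<i}. (s(i := a)) i \<noteq> (s(i := a)) j) \<and>
        m \<le> card (?T N - (s(i := a)) ` {..<Suc i})) \<longleftrightarrow> Suc m \<le> card (?T N - s ` {..<i})"
      unfolding im ne by simp
  qed
qed

lemma definable_type_count_ge:
  assumes "finite \<tau>" "\<pi> \<subseteq> \<tau>" "k \<le> d" "d > 0"
  shows "definable \<tau> n {} d (\<lambda>N s. k \<le> type_count \<tau> n N \<pi>)"
proof (cases "k = 0")
  \<comment> \<open>With no name and no quantifier available \<open>definable_at_least\<close> does
    not apply; the rank \<open>d > 0\<close> pays for a trivial sentence.\<close>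
  case True
  then show ?thesis using definable_True[of "{}" d] assms(4) by simp
next
  case False
  then show ?thesis
    using definable_at_least[OF assms(1,2), of 0 k n] assms(3)
    by (auto simp: type_count_def intro: definable_mono)
qed

lemma definable_equiv_d:
  assumes "finite \<tau>" "d > 0"
  shows "definable \<tau> n {} d (\<lambda>N s. equiv_d \<tau> n d M N)"
proof -
  have "definable \<tau> n {} d (\<lambda>N s. \<forall>\<pi>\<in>Pow \<tau>.
      type_count \<tau> n M \<pi> < d \<or> type_count \<tau> n N \<pi> < d \<longrightarrow>
        type_count \<tau> n M \<pi> = type_count \<tau> n N \<pi>)"
  proof (rule definable_finite_Ball)
    fix \<pi> assume "\<pi> \<in> Pow \<tau>"
    then have ge: "definable \<tau> n {} d (\<lambda>N s. k \<le> type_count \<tau> n N \<pi>)" if "k \<le> d" for k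
      using definable_type_count_ge assms that by auto
    let ?c = "type_count \<tau> n M \<pi>"
    show "definable \<tau> n {} d (\<lambda>N s. ?c < d \<or> type_count \<tau> n N \<pi> < d \<longrightarrow> ?c = type_count \<tau> n N \<pi>)"
    proof (cases "?c < d")
      case True
      \<comment> \<open>An exact count is a lower bound \<open>?c\<close> without the lower bound
        \<open>Suc ?c\<close>, whose rank is still at most \<open>d\<close>.\<close>
      have "definable \<tau> n {} d (\<lambda>N s. ?c \<le> type_count \<tau> n N \<pi> \<and> \<not> Suc ?c \<le> type_count \<tau> n N \<pi>)"
        using True by (intro definable_conj definable_not ge) auto
      then show ?thesis by (rule definable_cong) (use True in auto)
    next
      case False
      \<comment> \<open>Once \<open>M\<close> has at least \<open>d\<close> points of this type, the
        condition on \<open>N\<close> just says that \<open>N\<close> does too.\<close>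
      show ?thesis by (rule definable_cong[OF ge[OF order_refl]]) (use False in auto)
    qed
  qed (use assms in auto)
  then show ?thesis by (rule definable_cong) (auto simp: equiv_d_def)
qed

lemma exists_defining_sentence:
  assumes "finite \<tau>" "d > 0"
  shows "\<exists>\<phi>\<in>FO_sentences \<tau> d. defines_class \<tau> n d M \<phi>"
proof -
  obtain \<phi> where "set_fo \<phi> \<subseteq> \<tau>" "free_vars \<phi> \<subseteq> {}" "quantifier_rank \<phi> \<le> d"
    "\<And>N s. sat n N s \<phi> \<longleftrightarrow> equiv_d \<tau> n d M N"
    using definable_equiv_d[OF assms] unfolding definable_def by blast
  then show ?thesis
    unfolding FO_sentences_def defines_class_def equiv_class_def true_in_def
    by (intro bexI[of _ \<phi>]) auto
qed

subsection \<open>Counting models with prescribed type counts\<close>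

lemma type_count_eq_0:
  assumes "\<not> \<pi> \<subseteq> \<tau>"
  shows "type_count \<tau> n M \<pi> = 0"
  using assms unfolding type_count_def by auto

lemma sum_type_count:
  assumes "finite \<tau>"
  shows "(\<Sum>\<pi>\<in>Pow \<tau>. type_count \<tau> n M \<pi>) = n"
proof -
  have "(\<Sum>\<pi>\<in>Pow \<tau>. sum (\<lambda>_. 1) {a \<in> {1..n}. point_type \<tau> M a = \<pi>}) = sum (\<lambda>_. 1) {1..n}"
    by (rule sum.group) (use assms in auto)
  also have "\<dots> = n" by simp
  finally show ?thesis unfolding type_count_def card_eq_sum .
qed

text \<open>A model is coded as a word of length \<open>n\<close> over the types, so that models
  with equal counts become arrangements of one multiset.\<close>

definition type_list :: "'p set \<Rightarrow> nat \<Rightarrow> ('p \<Rightarrow> nat set) \<Rightarrow> 'p set list" where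
  "type_list \<tau> n M = map (point_type \<tau> M) [1..<Suc n]"

lemma count_type_list: "count (mset (type_list \<tau> n M)) \<pi> = type_count \<tau> n M \<pi>"
proof -
  have "mset (type_list \<tau> n M) = image_mset (point_type \<tau> M) (mset_set {1..n})"
    unfolding type_list_def mset_map mset_upt atLeastLessThanSuc_atLeastAtMost ..
  also have "count \<dots> \<pi> = (\<Sum>a \<in> {a \<in> {1..n}. point_type \<tau> M a = \<pi>}. 1)"
    unfolding count_image_mset' by (rule sum.cong) auto
  finally show ?thesis unfolding type_count_def by simp
qed

lemma inj_on_type_list: "inj_on (type_list \<tau> n) (models \<tau> n)"
proof (rule inj_onI)
  fix M N assume M: "M \<in> models \<tau> n" and N: "N \<in> models \<tau> n"
    and eq: "type_list \<tau> n M = type_list \<tau> n N"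
  have "\<forall>a\<in>set [1..<Suc n]. point_type \<tau> M a = point_type \<tau> N a"
    using eq unfolding type_list_def map_eq_conv .
  then have pt: "point_type \<tau> M a = point_type \<tau> N a" if "a \<in> {1..n}" for a
    by (rule bspec) (use that in auto)
  show "M = N"
  proof (rule PiE_ext)
    show "M \<in> \<tau> \<rightarrow>\<^sub>E Pow {1..n}" "N \<in> \<tau> \<rightarrow>\<^sub>E Pow {1..n}"
      using M N unfolding models_def by auto
    fix P assume P: "P \<in> \<tau>"
    then have "M P \<subseteq> {1..n}" "N P \<subseteq> {1..n}" using M N unfolding models_def by auto
    moreover have "a \<in> M P \<longleftrightarrow> a \<in> N P" if "a \<in> {1..n}" for a
      using pt[OF that] P by blast
    ultimately show "M P = N P" by blast
  qed
qed

text \<open>The words of these models are permutations of one multiset, and these are counted by a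
  multinomial coefficient. The product form avoids division.\<close>

lemma card_models_same_counts:
  assumes "finite \<tau>"
  shows "card {N \<in> models \<tau> n. \<forall>\<pi>\<subseteq>\<tau>. type_count \<tau> n N \<pi> = type_count \<tau> n M \<pi>} *
    (\<Prod>\<pi>\<in>Pow \<tau>. fact (type_count \<tau> n M \<pi>)) \<le> (fact n :: nat)"
proof -
  define A where "A = mset (type_list \<tau> n M)"
  let ?C = "{N \<in> models \<tau> n. \<forall>\<pi>\<subseteq>\<tau>. type_count \<tau> n N \<pi> = type_count \<tau> n M \<pi>}"
  have "type_list \<tau> n ` ?C \<subseteq> permutations_of_multiset A"
  proof
    fix xs assume "xs \<in> type_list \<tau> n ` ?C"
    then obtain N where xs: "xs = type_list \<tau> n N"
      and N: "\<forall>\<pi>\<subseteq>\<tau>. type_count \<tau> n N \<pi> = type_count \<tau> n M \<pi>" by blast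
    have "mset xs = A"
    proof (rule multiset_eqI)
      show "count (mset xs) \<pi> = count A \<pi>" for \<pi>
        unfolding xs A_def count_type_list using N type_count_eq_0 by metis
    qed
    then show "xs \<in> permutations_of_multiset A" by (rule permutations_of_multisetI)
  qed
  then have "card ?C \<le> card (permutations_of_multiset A)"
    by (rule card_inj_on_le[rotated])
      (auto intro: inj_on_subset[OF inj_on_type_list])
  \<comment> \<open>Types without points do not occur in \<open>A\<close>, but they contribute only
    the factor \<open>fact 0 = 1\<close>.\<close>
  moreover have "(\<Prod>\<pi>\<in>Pow \<tau>. fact (type_count \<tau> n M \<pi>)) = (\<Prod>\<pi>\<in>set_mset A. fact (count A \<pi>) :: nat)"
  proof (rule prod.mono_neutral_cong_right)
    show "finite (Pow \<tau>)" using assms by simp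
    show "set_mset A \<subseteq> Pow \<tau>" unfolding A_def type_list_def by auto
    have "type_count \<tau> n M \<pi> = 0" if "\<pi> \<notin># A" for \<pi>
      using that unfolding count_type_list[symmetric] A_def[symmetric] by (simp only: not_in_iff)
    then show "\<forall>\<pi>\<in>Pow \<tau> - set_mset A. fact (type_count \<tau> n M \<pi>) = (1 :: nat)" by simp
    show "fact (type_count \<tau> n M \<pi>) = (fact (count A \<pi>) :: nat)" for \<pi>
      unfolding A_def count_type_list ..
  qed
  ultimately have "card ?C * (\<Prod>\<pi>\<in>Pow \<tau>. fact (type_count \<tau> n M \<pi>)) \<le>
      card (permutations_of_multiset A) * (\<Prod>\<pi>\<in>set_mset A. fact (count A \<pi>))"
    by (simp only: mult_le_mono1)
  also have "\<dots> = fact (size A)"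
    by (rule card_permutations_of_multiset_aux)
  also have "size A = n" unfolding A_def type_list_def by simp
  finally show ?thesis .
qed

section \<open>Maximality of the given multinomial coefficient\<close>

text \<open>Each side times its binomial coefficient is \<open>fact m\<close>, and binomial
  coefficients increase up to the middle.\<close>

lemma fact_mult_fact_antimono:
  fixes k h m :: nat
  assumes "k \<le> h" "2 * h \<le> m"
  shows "fact h * fact (m - h) \<le> (fact k * fact (m - k) :: nat)"
proof -
  have q: "m choose k > 0" using assms by simp
  have "fact h * fact (m - h) * (m choose k) \<le> (fact h * fact (m - h) * (m choose h) :: nat)"
    by (intro mult_le_mono2 binomial_mono) (use assms in auto)
  also have "fact h * fact (m - h) * (m choose h) = (fact k * fact (m - k) * (m choose k) :: nat)"
    using binomial_fact_lemma[of h m] binomial_fact_lemma[of k m] assms by simp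
  finally show ?thesis using q mult_le_cancel2 by blast
qed

text \<open>The entries are changed from \<open>h\<close> to \<open>c x\<close> one at a time, the
  remainder absorbing the difference; by \<open>fact_mult_fact_antimono\<close> no change decreases
  the product.\<close>

lemma prod_fact_ge:
  fixes c :: "'a \<Rightarrow> nat"
  assumes "finite S" "\<And>x. x \<in> S \<Longrightarrow> c x \<le> h" "(card S + 1) * h \<le> N"
  shows "fact h ^ card S * fact (N - card S * h) \<le> ((\<Prod>x\<in>S. fact (c x)) * fact (N - sum c S) :: nat)"
  using assms
proof (induction S arbitrary: N)
  case empty
  then show ?case by simp
next
  case (insert p S)
  \<comment> \<open>This is the share of \<open>p\<close> and the remainder together while the
    elements of \<open>S\<close> still have \<open>h\<close> each; the bound on \<open>N\<close>
    leaves at least \<open>2 * h\<close>.\<close>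
  define m where "m = N - card S * h"
  have cp: "c p \<le> h" using insert.prems by simp
  have m: "2 * h \<le> m" using insert.prems insert.hyps unfolding m_def by simp
  have eqs: "N - card (insert p S) * h = m - h" "N - c p - card S * h = m - c p"
    "N - c p - sum c S = N - sum c (insert p S)"
    using insert.hyps unfolding m_def by auto
  have "fact h ^ card (insert p S) * fact (N - card (insert p S) * h) =
      fact h ^ card S * (fact h * fact (m - h) :: nat)"
    unfolding eqs using insert.hyps by (simp add: mult_ac)
  also have "\<dots> \<le> fact h ^ card S * (fact (c p) * fact (m - c p))"
    by (intro mult_le_mono2 fact_mult_fact_antimono cp m)
  also have "\<dots> = fact (c p) * (fact h ^ card S * fact (N - c p - card S * h))"
    unfolding eqs by (simp add: mult_ac)
  also have "\<dots> \<le> fact (c p) * ((\<Prod>x\<in>S. fact (c x)) * fact (N - c p - sum c S))"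
  proof (intro mult_le_mono2 insert.IH)
    show "(card S + 1) * h \<le> N - c p" using insert.prems(2) insert.hyps cp by simp
  qed (use insert.prems in auto)
  also have "\<dots> = (\<Prod>x\<in>insert p S. fact (c x)) * fact (N - sum c (insert p S))"
    unfolding eqs using insert.hyps by (simp add: mult_ac)
  finally show ?case .
qed

text \<open>
  If at most one type has more than \<open>h\<close> points, then all type counts are determined by the class,
  and among the multinomial coefficients with such entries the given one is the largest.
\<close>

lemma card_equiv_class_le_multinomial:
  assumes \<tau>: "finite \<tau>" and t: "t = 2 ^ card \<tau>" and hd: "h < d" and th: "t * h \<le> n"
    and \<pi>0: "\<pi>0 \<subseteq> \<tau>" and small: "\<And>\<pi>. \<pi> \<subseteq> \<tau> \<Longrightarrow> \<pi> \<noteq> \<pi>0 \<Longrightarrow> type_count \<tau> n M \<pi> \<le> h"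
  shows "real (card (equiv_class \<tau> n d M)) \<le> multinomial n (replicate (t - 1) h @ [n - (t - 1) * h])"
proof -
  define S where "S = Pow \<tau> - {\<pi>0}"
  let ?c = "type_count \<tau> n M"
  have S: "finite S" "card S = t - 1" "Pow \<tau> = insert \<pi>0 S" "\<pi>0 \<notin> S"
    using \<tau> \<pi>0 unfolding S_def t by (auto simp: card_Pow)
  \<comment> \<open>The counts add up to \<open>n\<close>, so that of \<open>\<pi>0\<close> follows
    from the others even when it is at least \<open>d\<close>.\<close>
  have sum_eq: "type_count \<tau> n N \<pi>0 = n - sum (type_count \<tau> n N) S" for N
    using sum_type_count[OF \<tau>, of n N] S by simp
  have "equiv_class \<tau> n d M \<subseteq> {N \<in> models \<tau> n. \<forall>\<pi>\<subseteq>\<tau>. type_count \<tau> n N \<pi> = ?c \<pi>}"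
  proof
    fix N assume N: "N \<in> equiv_class \<tau> n d M"
    have same: "type_count \<tau> n N \<pi> = ?c \<pi>" if "\<pi> \<in> S" for \<pi>
    proof -
      have \<pi>: "\<pi> \<subseteq> \<tau>" "\<pi> \<noteq> \<pi>0" using that unfolding S_def by auto
      have "?c \<pi> < d" using small[OF \<pi>] hd by simp
      moreover have "equiv_d \<tau> n d M N" using N unfolding equiv_class_def by simp
      ultimately show ?thesis using \<pi>(1) unfolding equiv_d_def by metis
    qed
    have "sum (type_count \<tau> n N) S = sum ?c S" by (rule sum.cong) (simp_all add: same)
    then have "type_count \<tau> n N \<pi>0 = ?c \<pi>0" using sum_eq[of N] sum_eq[of M] by simp
    with same have "\<forall>\<pi>\<in>Pow \<tau>. type_count \<tau> n N \<pi> = ?c \<pi>" unfolding S(3) by simp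
    with N show "N \<in> {N \<in> models \<tau> n. \<forall>\<pi>\<subseteq>\<tau>. type_count \<tau> n N \<pi> = ?c \<pi>}"
      unfolding equiv_class_def by blast
  qed
  moreover have "finite (models \<tau> n)"
    unfolding models_def using \<tau> by (simp add: finite_PiE)
  ultimately have "card (equiv_class \<tau> n d M) \<le>
      card {N \<in> models \<tau> n. \<forall>\<pi>\<subseteq>\<tau>. type_count \<tau> n N \<pi> = ?c \<pi>}"
    by (intro card_mono) auto
  then have le: "card (equiv_class \<tau> n d M) * (\<Prod>\<pi>\<in>Pow \<tau>. fact (?c \<pi>)) \<le> fact n"
    by (rule order_trans[OF mult_le_mono1 card_models_same_counts[OF \<tau>]])
  define D :: nat where "D = fact h ^ (t - 1) * fact (n - (t - 1) * h)"
  have "D \<le> (\<Prod>\<pi>\<in>S. fact (?c \<pi>)) * fact (n - sum ?c S)"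
    unfolding D_def S(2)[symmetric]
  proof (rule prod_fact_ge)
    \<comment> \<open>This turns \<open>card S + 1\<close> into \<open>t\<close> despite the
      truncated subtraction in \<open>t - 1\<close>.\<close>
    have "t \<ge> 1" unfolding t by simp
    then show "(card S + 1) * h \<le> n" using th S(2) by simp
    show "?c \<pi> \<le> h" if "\<pi> \<in> S" for \<pi>
      using that small[of \<pi>] unfolding S_def by simp
  qed (rule S(1))
  also have "\<dots> = (\<Prod>\<pi>\<in>Pow \<tau>. fact (?c \<pi>))"
    unfolding S(3) using S(1,4) sum_eq[of M] by simp
  finally have "card (equiv_class \<tau> n d M) * D \<le> fact n"
    by (rule order_trans[OF mult_le_mono2 le])
  then have "real (card (equiv_class \<tau> n d M) * D) \<le> real (fact n)"
    by (rule of_nat_mono)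
  then have "real (card (equiv_class \<tau> n d M)) * real D \<le> fact n" by simp
  moreover have "D > 0" unfolding D_def by simp
  moreover have "(\<Prod>k\<leftarrow>replicate (t - 1) h @ [n - (t - 1) * h]. fact k) = real D"
    unfolding D_def by simp
  ultimately show ?thesis
    unfolding multinomial_def by (simp add: le_divide_eq)
qed

theorem theorem9:
  fixes \<tau> :: "'p set" and t d n h :: nat and M :: "'p \<Rightarrow> nat set"
  assumes "finite \<tau>"
    and "t = 2 ^ card \<tau>"
    and "d \<ge> 1"
    and "M \<in> models \<tau> n"
    and "h \<in> {1..d - 1}"
    and "t * h \<le> n"
    and "boltzmann_entropy \<tau> n d M >
           log 2 (multinomial n (replicate (t - 1) h @ [n - (t - 1) * h]))"
  shows "description_complexity \<tau> n d M > 3 * h - 3"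
proof -
  let ?c = "type_count \<tau> n M"
  have h: "h \<ge> 1" "h < d" using assms(5) by auto
  have finC: "finite (equiv_class \<tau> n d M)"
    unfolding equiv_class_def models_def using assms(1) by (simp add: finite_PiE)
  have "M \<in> equiv_class \<tau> n d M"
    using assms(4) unfolding equiv_class_def equiv_d_def by simp
  then have "card (equiv_class \<tau> n d M) > 0"
    using finC card_gt_0_iff by blast
  moreover have "multinomial n (replicate (t - 1) h @ [n - (t - 1) * h]) > 0"
    unfolding multinomial_def by simp
  ultimately have less: "multinomial n (replicate (t - 1) h @ [n - (t - 1) * h]) <
      real (card (equiv_class \<tau> n d M))"
    using assms(7) unfolding boltzmann_entropy_def by simp
  have large: "\<exists>\<pi>\<subseteq>\<tau>. \<pi> \<noteq> \<pi>0 \<and> h < ?c \<pi>" if "\<pi>0 \<subseteq> \<tau>" for \<pi>0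
  proof (rule ccontr)
    assume "\<not> (\<exists>\<pi>\<subseteq>\<tau>. \<pi> \<noteq> \<pi>0 \<and> h < ?c \<pi>)"
    then have "?c \<pi> \<le> h" if "\<pi> \<subseteq> \<tau>" "\<pi> \<noteq> \<pi>0" for \<pi>
      using that by (meson not_le)
    from card_equiv_class_le_multinomial[OF assms(1,2) h(2) assms(6) \<open>\<pi>0 \<subseteq> \<tau>\<close> this] less
    show False by simp
  qed
  \<comment> \<open>The empty type is only a starting value: excluding it gives one large type, and
    excluding that one gives a second.\<close>
  from large[of "{}"] obtain \<pi>1 where \<pi>1: "\<pi>1 \<subseteq> \<tau>" "h < ?c \<pi>1" by blast
  from large[of \<pi>1] \<pi>1(1) obtain \<pi>2 where \<pi>2: "\<pi>2 \<subseteq> \<tau>" "\<pi>1 \<noteq> \<pi>2" "h < ?c \<pi>2" by blast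
  obtain B where B: "B \<in> models \<tau> n" "similar \<tau> n h M B" "type_count \<tau> n B \<pi>1 = h"
    by (rule exists_similar_model[OF assms(4) \<pi>2(2) \<pi>1(1) \<pi>2(1)
      less_imp_le[OF \<pi>1(2)] less_imp_le[OF \<pi>2(3)]])
  \<comment> \<open>The count \<open>h\<close> in \<open>B\<close> is below \<open>d\<close>, so
    equivalence would force the same count in \<open>M\<close>, which has more.\<close>
  have "\<not> equiv_d \<tau> n d M B"
    using \<pi>1 B(3) h unfolding equiv_d_def by auto
  then have nB: "B \<notin> equiv_class \<tau> n d M" unfolding equiv_class_def by simp
  have nonempty: "\<exists>a\<in>{1..n}. point_type \<tau> N a = \<pi>1" if "type_count \<tau> n N \<pi>1 > 0" for N
    using that unfolding type_count_def by (fastforce simp: card_gt_0_iff)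
  have "type_count \<tau> n M \<pi>1 > 0" "type_count \<tau> n B \<pi>1 > 0"
    using \<pi>1(2) B(3) h(1) by auto
  with nonempty[of M] nonempty[of B] obtain a b where ab: "a \<in> {1..n}" "b \<in> {1..n}" "point_type \<tau> M a = point_type \<tau> B b"
    by blast
  \<comment> \<open>A defining sentence must exist for \<open>LEAST\<close> to be the size of
    one.\<close>
  have ex: "\<exists>k. \<exists>\<phi>\<in>FO_sentences \<tau> d. defines_class \<tau> n d M \<phi> \<and> formula_size \<phi> = k"
    using exists_defining_sentence[OF assms(1), of d n M] assms(3) by auto
  obtain \<phi> where \<phi>: "\<phi> \<in> FO_sentences \<tau> d" "defines_class \<tau> n d M \<phi>"
    and size: "formula_size \<phi> = description_complexity \<tau> n d M"
    using LeastI_ex[OF ex] unfolding description_complexity_def by blast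
  have "true_in n M \<phi>" "\<not> true_in n B \<phi>"
    using \<phi>(2) \<open>M \<in> equiv_class \<tau> n d M\<close> nB B(1) unfolding defines_class_def by auto
  then have "3 * h \<le> formula_size \<phi>"
    using formula_size_ge_if_distinguishes[OF B(2) h(1) _ _ _ _ ab] \<phi>(1)
    unfolding FO_sentences_def by blast
  \<comment> \<open>As \<open>h \<ge> 1\<close>, the truncated \<open>3 * h - 3\<close> is strictly
    below \<open>3 * h\<close>.\<close>
  then show ?thesis using size h(1) by linarith
qed

end
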